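(* Let $\Gamma$ be a graph with maximum degree three and let $R$ be the set of removable vertices of $\Gamma$. Then $\Gamma$ admits a partial orientation as a quasi-transitive mixed graph if and only if $\Gamma - R$ admits a partial orientation as a quasi-transitive mixed graph.
   Context: In a graph $\Gamma$ of maximum degree three, a vertex $u$ is removable when $u$ has degree two, and its two neighbours are adjacent, both have degree three, and have exactly one common neighbour. A mixed graph has a vertex set, a set of (undirected) edges and a set of arcs, with at most one edge or arc between any pair of vertices. A partial orientation of a graph is a mixed graph obtained by orienting some of its edges as arcs. A $2$-dipath is a directed path $xyz$ consisting of arcs $x\to y$, $y\to z$; it is induced if $x$ and $z$ are not joined by an edge or arc. A mixed graph $H$ is quasi-transitive when (1) it has no induced $2$-dipath and (2) for every edge $xy$ there is $w$ with $xwy$ or $ywx$ a $2$-dipath. *)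

theory Defs
  imports Main
begin

record 'a ugraph =
  verts :: "'a set"
  edges :: "'a set set"

definition simple_graph :: "'a ugraph \<Rightarrow> bool" where
  "simple_graph G \<longleftrightarrow> (\<forall>e\<in>edges G. e \<subseteq> verts G \<and> card e = 2)"

definition nbrs :: "'a ugraph \<Rightarrow> 'a \<Rightarrow> 'a set" where
  "nbrs G v = {w. {v, w} \<in> edges G}"

definition degree :: "'a ugraph \<Rightarrow> 'a \<Rightarrow> nat" where
  "degree G v = card (nbrs G v)"

text \<open>The vertex set may be infinite. Finiteness of neighbourhoods is required explicitly because
  \<^const>\<open>card\<close> is 0 on infinite sets.\<close>

definition has_max_degree :: "'a ugraph \<Rightarrow> nat \<Rightarrow> bool" where
  "has_max_degree G d \<longleftrightarrow>
     (\<forall>v\<in>verts G. finite (nbrs G v) \<and> degree G v \<le> d) \<and> (\<exists>v\<in>verts G. degree G v = d)"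

definition removable :: "'a ugraph \<Rightarrow> 'a \<Rightarrow> bool" where
  "removable G u \<longleftrightarrow> u \<in> verts G \<and> degree G u = 2 \<and>
     (\<exists>v w. v \<noteq> w \<and> nbrs G u = {v, w} \<and> {v, w} \<in> edges G \<and>
            degree G v = 3 \<and> degree G w = 3 \<and> card (nbrs G v \<inter> nbrs G w) = 1)"

definition delete_verts :: "'a ugraph \<Rightarrow> 'a set \<Rightarrow> 'a ugraph" where
  "delete_verts G S = \<lparr>verts = verts G - S, edges = {e \<in> edges G. e \<inter> S = {}}\<rparr>"

record 'a mgraph =
  mverts :: "'a set"
  medges :: "'a set set"
  marcs :: "('a \<times> 'a) set"

definition mixed_graph :: "'a mgraph \<Rightarrow> bool" where
  "mixed_graph H \<longleftrightarrow>
     (\<forall>e\<in>medges H. e \<subseteq> mverts H \<and> card e = 2) \<and>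
     (\<forall>(x, y)\<in>marcs H. x \<in> mverts H \<and> y \<in> mverts H \<and> x \<noteq> y \<and>
        (y, x) \<notin> marcs H \<and> {x, y} \<notin> medges H)"

definition partial_orientation :: "'a mgraph \<Rightarrow> 'a ugraph \<Rightarrow> bool" where
  "partial_orientation H G \<longleftrightarrow>
     mixed_graph H \<and> mverts H = verts G \<and>
     medges H \<union> {{x, y} | x y. (x, y) \<in> marcs H} = edges G"

definition madj :: "'a mgraph \<Rightarrow> 'a \<Rightarrow> 'a \<Rightarrow> bool" where
  "madj H x y \<longleftrightarrow> {x, y} \<in> medges H \<or> (x, y) \<in> marcs H \<or> (y, x) \<in> marcs H"

definition two_dipath :: "'a mgraph \<Rightarrow> 'a \<Rightarrow> 'a \<Rightarrow> 'a \<Rightarrow> bool" where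
  "two_dipath H x y z \<longleftrightarrow> distinct [x, y, z] \<and> (x, y) \<in> marcs H \<and> (y, z) \<in> marcs H"

definition induced_two_dipath :: "'a mgraph \<Rightarrow> 'a \<Rightarrow> 'a \<Rightarrow> 'a \<Rightarrow> bool" where
  "induced_two_dipath H x y z \<longleftrightarrow> two_dipath H x y z \<and> \<not> madj H x z"

definition quasi_transitive :: "'a mgraph \<Rightarrow> bool" where
  "quasi_transitive H \<longleftrightarrow>
     (\<nexists>x y z. induced_two_dipath H x y z) \<and>
     (\<forall>x y. {x, y} \<in> medges H \<longrightarrow> (\<exists>w. two_dipath H x w y \<or> two_dipath H y w x))"

end

theory Submission imports Defs begin

text \<open>
  A removable vertex \<open>u\<close> with neighbours \<open>v\<close>, \<open>w\<close> lies in a triangle whose other two corners each have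
  exactly one further neighbour, \<open>x\<close> at \<open>v\<close> and \<open>y\<close> at \<open>w\<close>. The edges \<open>vx\<close> and \<open>wy\<close> lie in no triangle,
  so they must be oriented, and avoiding induced 2-dipaths forces exactly one of \<open>v\<close>, \<open>w\<close>
  to be a source and the other one to be a sink (apart from undirected triangle edges). Hence, when
  \<open>u\<close> is deleted, the edge \<open>vw\<close> may be oriented from source to sink; conversely, once \<open>u\<close> is gone
  \<open>vw\<close> must be an arc from a source to a sink, say \<open>v \<rightarrow> w\<close>, and \<open>v \<rightarrow> u \<rightarrow> w\<close> can be
  added. Triangles of distinct removable vertices do not interfere with each other.
\<close>

section \<open>Removable vertices as apexes of triangles\<close>

text \<open>Listing the neighbourhoods explicitly settles every adjacency at the corners. The part
  \<open>x \<noteq> y\<close> of distinctness encodes that \<open>u\<close> is the only common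
  neighbour of \<open>v\<close> and \<open>w\<close>.\<close>

definition pendant_triangle :: "'a ugraph \<Rightarrow> 'a \<Rightarrow> 'a \<Rightarrow> 'a \<Rightarrow> 'a \<Rightarrow> 'a \<Rightarrow> bool" where
  "pendant_triangle G u v w x y \<longleftrightarrow> distinct [u, v, w, x, y] \<and>
     nbrs G u = {v, w} \<and> nbrs G v = {u, w, x} \<and> nbrs G w = {u, v, y}"

lemma nbrs_sym: "y \<in> nbrs G x \<longleftrightarrow> x \<in> nbrs G y"
  by (simp add: nbrs_def insert_commute)

lemma nbrs_verts:
  assumes "simple_graph G" "y \<in> nbrs G x"
  shows "x \<in> verts G" "y \<in> verts G" "x \<noteq> y"
  using assms by (auto simp: simple_graph_def nbrs_def)

lemma pendant_triangle_sym:
  "pendant_triangle G u v w x y \<Longrightarrow> pendant_triangle G u w v y x"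
  by (auto simp: pendant_triangle_def)

lemma pendant_triangle_not_adj:
  assumes "pendant_triangle G u v w x y"
  shows "x \<notin> nbrs G u" "x \<notin> nbrs G w" "u \<notin> nbrs G x" "w \<notin> nbrs G x"
proof -
  show *: "x \<notin> nbrs G u" "x \<notin> nbrs G w" using assms by (auto simp: pendant_triangle_def)
  show "u \<notin> nbrs G x" "w \<notin> nbrs G x" using * by (simp_all add: nbrs_sym[of _ G x])
qed

lemma card_3_third_elem:
  assumes "card A = 3" "a \<in> A" "b \<in> A" "a \<noteq> b"
  obtains c where "A = {a, b, c}" "c \<noteq> a" "c \<noteq> b"
proof -
  have "card (A - {a, b}) = 1"
    using assms by (simp add: card_Diff_subset)
  then obtain c where "A - {a, b} = {c}"
    by (auto simp: card_1_singleton_iff)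
  then show thesis using that[of c] assms by blast
qed

text \<open>Degree three leaves each of \<open>v\<close> and \<open>w\<close> one neighbour outside
  the triangle. If these two coincided, \<open>v\<close> and \<open>w\<close> would have a second
  common neighbour besides \<open>u\<close>.\<close>

lemma removable_iff_pendant_triangle:
  assumes "simple_graph G"
  shows "removable G u \<longleftrightarrow> (\<exists>v w x y. pendant_triangle G u v w x y)"
proof
  assume "removable G u"
  then obtain v w where vw: "v \<noteq> w" "nbrs G u = {v, w}" "w \<in> nbrs G v"
    "card (nbrs G v) = 3" "card (nbrs G w) = 3" "card (nbrs G v \<inter> nbrs G w) = 1"
    by (auto simp: removable_def degree_def nbrs_def)
  have u: "u \<in> nbrs G v" "u \<in> nbrs G w" "v \<in> nbrs G w"
    using vw nbrs_sym by fastforce+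
  note ne = nbrs_verts(3)[OF assms]
  have d: "u \<noteq> v" "u \<noteq> w" using ne u by blast+
  obtain x where x: "nbrs G v = {u, w, x}" "x \<noteq> u" "x \<noteq> w"
    using card_3_third_elem vw u d by metis
  obtain y where y: "nbrs G w = {u, v, y}" "y \<noteq> u" "y \<noteq> v"
    using card_3_third_elem vw u d by metis
  have "x \<noteq> v" "y \<noteq> w" using ne[of x v] ne[of y w] x y by auto
  moreover have "x \<noteq> y"
  proof
    assume "x = y"
    then have "nbrs G v \<inter> nbrs G w = {u, x}" using x y d vw by auto
    then show False using vw x by auto
  qed
  ultimately show "\<exists>v w x y. pendant_triangle G u v w x y"
    using vw(1,2) x y d unfolding pendant_triangle_def
    by (metis distinct_length_2_or_more distinct_singleton)
next
  assume "\<exists>v w x y. pendant_triangle G u v w x y"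
  then obtain v w x y where t: "pendant_triangle G u v w x y" by blast
  then have "nbrs G v \<inter> nbrs G w = {u}" "w \<in> nbrs G v"
    "card (nbrs G u) = 2" "card (nbrs G v) = 3" "card (nbrs G w) = 3" "v \<noteq> w" "nbrs G u = {v, w}"
    by (auto simp: pendant_triangle_def)
  moreover from this have "{v, w} \<in> edges G" by (simp add: nbrs_def)
  moreover from calculation have "u \<in> verts G" using nbrs_verts(1)[OF assms, of v u] by simp
  ultimately show "removable G u"
    unfolding removable_def degree_def
    by - (intro conjI, simp, simp, rule exI[of _ v], rule exI[of _ w], simp)
qed

text \<open>Ensures that corners and outer neighbours survive the deletion, so that distinct
  triangles do not interfere. The corner \<open>v\<close> has degree three; a removable
  \<open>x\<close> would put the edge \<open>vx\<close> into a triangle.\<close>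

lemma pendant_triangle_not_removable:
  assumes "simple_graph G" "pendant_triangle G u v w x y"
  shows "\<not> removable G v" "\<not> removable G x"
proof -
  show "\<not> removable G v"
    using assms(2) by (auto simp: pendant_triangle_def removable_def degree_def)
  show "\<not> removable G x"
  proof
    assume "removable G x"
    then obtain a b where ab: "nbrs G x = {a, b}" "a \<noteq> b" "b \<in> nbrs G a" 
      by (auto simp: removable_def nbrs_def)
    have "v \<in> nbrs G x"
      using assms(2) by (simp add: nbrs_sym[of v G x] pendant_triangle_def)
    \<comment> \<open>\<open>v\<close> is one of the two adjacent neighbours \<open>a\<close>,
      \<open>b\<close> of \<open>x\<close>; \<open>c\<close> is the other one.\<close>
    then obtain c where "c \<in> nbrs G x" "c \<in> nbrs G v" 
      using ab nbrs_sym[of b G a] by auto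
    then have "x \<in> nbrs G x"
      using pendant_triangle_not_adj[OF assms(2)] assms(2) by (auto simp: pendant_triangle_def)
    then show False using nbrs_verts(3)[OF assms(1)] by blast
  qed
qed

lemma pendant_triangle_nbr_disjoint:
  assumes "simple_graph G" "pendant_triangle G u v w x y"
  shows "nbrs G v \<inter> nbrs G x = {}"
  using assms(2) pendant_triangle_not_adj[OF assms(2)] nbrs_verts(3)[OF assms(1), of x x]
  by (auto simp: pendant_triangle_def)

text \<open>The edge \<open>vw\<close> determines its apex as the single common neighbour of its
  ends, and then the outer neighbours as what remains. Hence an orientation chosen for
  \<open>vw\<close> depends on one triangle only.\<close>

lemma pendant_triangle_unique:
  assumes "pendant_triangle G u v w x y" "pendant_triangle G u' v w x' y'"
  shows "u' = u" "x' = x" "y' = y"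
proof -
  have "nbrs G v \<inter> nbrs G w = {u}" "nbrs G v \<inter> nbrs G w = {u'}"
    using assms by (auto simp: pendant_triangle_def)
  then show "u' = u" by simp
  then show "x' = x" "y' = y"
    using assms by (auto simp: pendant_triangle_def doubleton_eq_iff)
qed

section \<open>Vertex deletion, partial orientations and quasi-transitivity\<close>

lemma nbrs_delete_verts:
  "nbrs (delete_verts G S) x = (if x \<in> S then {} else nbrs G x - S)"
  by (auto simp: nbrs_def delete_verts_def)

lemma simple_graph_delete_verts: "simple_graph G \<Longrightarrow> simple_graph (delete_verts G S)"
  by (auto simp: simple_graph_def delete_verts_def)

lemma madj_partial_orientation:
  assumes "partial_orientation H G"
  shows "madj H x y \<longleftrightarrow> y \<in> nbrs G x"
proof -
  have "edges G = medges H \<union> {{x, y} | x y. (x, y) \<in> marcs H}"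
    using assms by (simp add: partial_orientation_def)
  then show ?thesis
    by (auto simp: madj_def nbrs_def doubleton_eq_iff)
qed

lemma partial_orientation_arc:
  assumes "partial_orientation H G" "(x, y) \<in> marcs H"
  shows "y \<in> nbrs G x" "x \<in> nbrs G y" "(y, x) \<notin> marcs H" "{x, y} \<notin> medges H" "x \<noteq> y"
  using assms madj_partial_orientation[OF assms(1)]
  by (auto simp: partial_orientation_def mixed_graph_def madj_def)

lemma simple_edgeE:
  assumes "simple_graph G" "e \<in> edges G"
  obtains x y where "e = {x, y}" "y \<in> nbrs G x"
proof -
  have "card e = 2" using assms by (auto simp: simple_graph_def)
  then show thesis using that assms(2) by (auto simp: card_2_iff nbrs_def)
qed

text \<open>Replaces the equality of edge sets by conditions on ordered pairs and
  \<open>nbrs\<close>, the form in which both constructions below are checked.\<close>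

lemma partial_orientationI:
  assumes "simple_graph G" "mverts H = verts G"
    and "medges H \<subseteq> edges G"
    and "\<And>x y. (x, y) \<in> marcs H \<Longrightarrow> y \<in> nbrs G x \<and> (y, x) \<notin> marcs H \<and> {x, y} \<notin> medges H"
    and "\<And>x y. y \<in> nbrs G x \<Longrightarrow> madj H x y"
  shows "partial_orientation H G"
proof -
  have "mixed_graph H"
    unfolding mixed_graph_def
  proof (intro conjI ballI)
    fix e assume "e \<in> medges H"
    then have "e \<in> edges G" using assms(3) by blast
    then show "e \<subseteq> mverts H" "card e = 2" using assms(1,2) by (auto simp: simple_graph_def)
  next
    fix a assume "a \<in> marcs H"
    moreover obtain x y where a: "a = (x, y)" by fastforce
    ultimately have "y \<in> nbrs G x" "(y, x) \<notin> marcs H" "{x, y} \<notin> medges H"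
      using assms(4)[of x y] by simp_all
    then show "case a of (x, y) \<Rightarrow> x \<in> mverts H \<and> y \<in> mverts H \<and> x \<noteq> y \<and>
        (y, x) \<notin> marcs H \<and> {x, y} \<notin> medges H"
      using assms(2) nbrs_verts[OF assms(1), of y x] a by simp
  qed
  moreover have "edges G \<subseteq> medges H \<union> {{x, y} | x y. (x, y) \<in> marcs H}"
  proof
    fix e assume "e \<in> edges G"
    then obtain x y where "e = {x, y}" "y \<in> nbrs G x" using simple_edgeE[OF assms(1)] by blast
    then show "e \<in> medges H \<union> {{x, y} | x y. (x, y) \<in> marcs H}"
      using assms(5)[of y x] unfolding madj_def by (auto simp: insert_commute)
  qed
  moreover have "{{x, y} | x y. (x, y) \<in> marcs H} \<subseteq> edges G"
    using assms(4) by (auto simp: nbrs_def)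
  ultimately show ?thesis using assms(2,3) unfolding partial_orientation_def by blast
qed

text \<open>The 2-dipath required by an undirected edge would have a common neighbour of its ends as
  middle vertex.\<close>

lemma quasi_transitive_triangle_free_arc:
  assumes "partial_orientation H G" "quasi_transitive H" "y \<in> nbrs G x"
    and "nbrs G x \<inter> nbrs G y = {}"
  shows "(x, y) \<in> marcs H \<or> (y, x) \<in> marcs H"
proof -
  have "{x, y} \<notin> medges H"
  proof
    assume "{x, y} \<in> medges H"
    then obtain t where "two_dipath H x t y \<or> two_dipath H y t x"
      using assms(2) unfolding quasi_transitive_def by blast
    then have "t \<in> nbrs G x \<inter> nbrs G y"
      using partial_orientation_arc[OF assms(1)] by (auto simp: two_dipath_def)
    then show False using assms(4) by blast
  qed
  then show ?thesis
    using madj_partial_orientation[OF assms(1), of x y] assms(3) by (auto simp: madj_def)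
qed

lemma quasi_transitive_two_dipath_adj:
  assumes "partial_orientation H G" "quasi_transitive H" "(x, y) \<in> marcs H" "(y, z) \<in> marcs H"
  shows "z \<in> nbrs G x"
proof -
  \<comment> \<open>Distinctness of \<open>x\<close> and \<open>z\<close> comes from the absence of
    opposite arcs.\<close>
  have "two_dipath H x y z"
    using assms partial_orientation_arc[OF assms(1)] by (auto simp: two_dipath_def)
  then show ?thesis
    using assms(2) madj_partial_orientation[OF assms(1)]
    by (auto simp: quasi_transitive_def induced_two_dipath_def)
qed

subsection \<open>Deleting the removable vertices\<close>

lemma pendant_triangle_source_or_sink:
  assumes G: "simple_graph G" and H: "partial_orientation H G" "quasi_transitive H"
    and t: "pendant_triangle G u v w x y"
  shows "(v, x) \<in> marcs H \<and> (y, w) \<in> marcs H \<and> (w, v) \<notin> marcs H \<or>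
         (x, v) \<in> marcs H \<and> (w, y) \<in> marcs H \<and> (v, w) \<notin> marcs H"
proof -
  note t' = pendant_triangle_sym[OF t]
  note adj = quasi_transitive_two_dipath_adj[OF H]
  have vx: "(v, x) \<in> marcs H \<or> (x, v) \<in> marcs H"
    using quasi_transitive_triangle_free_arc[OF H _ pendant_triangle_nbr_disjoint[OF G t]] t
    by (simp add: pendant_triangle_def)
  have wy: "(w, y) \<in> marcs H \<or> (y, w) \<in> marcs H"
    using quasi_transitive_triangle_free_arc[OF H _ pendant_triangle_nbr_disjoint[OF G t']] t
    by (simp add: pendant_triangle_def)
  have na: "x \<notin> nbrs G u" "x \<notin> nbrs G w" "y \<notin> nbrs G u" "y \<notin> nbrs G v"
    "u \<notin> nbrs G x" "w \<notin> nbrs G x" "u \<notin> nbrs G y" "v \<notin> nbrs G y"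
    using pendant_triangle_not_adj[OF t] pendant_triangle_not_adj[OF t'] by simp_all
  \<comment> \<open>If \<open>vw\<close> is undirected, its 2-dipath must pass through
    \<open>u\<close>, the only common neighbour.\<close>
  have vw: "(v, w) \<in> marcs H \<or> (w, v) \<in> marcs H \<or>
      (v, u) \<in> marcs H \<and> (u, w) \<in> marcs H \<or> (w, u) \<in> marcs H \<and> (u, v) \<in> marcs H"
  proof (cases "{v, w} \<in> medges H")
    case True
    then obtain s where "two_dipath H v s w \<or> two_dipath H w s v"
      using H(2) unfolding quasi_transitive_def by blast
    moreover from this have "s \<in> nbrs G v \<inter> nbrs G w"
      using partial_orientation_arc[OF H(1)] by (auto simp: two_dipath_def)
    then have "s = u" using t by (auto simp: pendant_triangle_def)
    ultimately show ?thesis by (auto simp: two_dipath_def)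
  next
    case False
    have "w \<in> nbrs G v" using t by (simp add: pendant_triangle_def)
    with False show ?thesis
      using madj_partial_orientation[OF H(1), of v w] by (auto simp: madj_def)
  qed
  \<comment> \<open>Given \<open>v \<rightarrow> x\<close>, no arc from \<open>u\<close> or
    \<open>w\<close> enters \<open>v\<close>, as neither is adjacent to \<open>x\<close>. So
    \<open>vw\<close> yields an arc into \<open>w\<close> from \<open>v\<close> or \<open>u\<close>,
    and this rules out \<open>w \<rightarrow> y\<close>. The other case is symmetric.\<close>
  show ?thesis using vx wy vw adj na by meson
qed

text \<open>Only an edge opposite a removed vertex can lose its 2-dipath. Directing it from source
  to sink removes the need for one and creates no new 2-dipath.\<close>

lemma quasi_transitive_delete_removable:
  assumes G: "simple_graph G" and R: "R = {u. removable G u}"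
    and H: "partial_orientation H G" "quasi_transitive H"
  shows "\<exists>K. partial_orientation K (delete_verts G R) \<and> quasi_transitive K"
proof -
  \<comment> \<open>The arc \<open>v \<rightarrow> x\<close> identifies \<open>v\<close> as the
    source, which fixes the direction of the new arc.\<close>
  define N where "N = {(v, w). \<exists>u x y. pendant_triangle G u v w x y \<and> {v, w} \<in> medges H \<and> (v, x) \<in> marcs H}"
  define K where "K = \<lparr>mverts = verts G - R,
    medges = {e \<in> medges H. e \<inter> R = {} \<and> \<not> (\<exists>u v w x y. pendant_triangle G u v w x y \<and> e = {v, w})},
    marcs = {(p, q) \<in> marcs H. p \<notin> R \<and> q \<notin> R} \<union> N\<rparr>"
  let ?D = "delete_verts G R"
  note arc = partial_orientation_arc[OF H(1)]
  note nrem = pendant_triangle_not_removable[OF G]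
  note sos = pendant_triangle_source_or_sink[OF G H]
  have arcs_K: "(p, q) \<in> marcs K \<longleftrightarrow> (p, q) \<in> marcs H \<and> p \<notin> R \<and> q \<notin> R \<or> (p, q) \<in> N" for p q
    by (auto simp: K_def)
  have N_nbrs: "w \<in> nbrs ?D v" if vw: "(v, w) \<in> N" for v w
  proof -
    obtain u x y where t: "pendant_triangle G u v w x y"
      using vw unfolding N_def by blast
    have "v \<notin> R" "w \<notin> R" using nrem(1)[OF t] nrem(1)[OF pendant_triangle_sym[OF t]] R by auto
    then show ?thesis using t by (simp add: nbrs_delete_verts pendant_triangle_def)
  qed
  \<comment> \<open>By uniqueness both memberships concern the same triangle, where
    \<open>v \<rightarrow> x\<close> and \<open>w \<rightarrow> y\<close> cannot both hold.\<close>
  have N_anti: "(w, v) \<notin> N" if vw: "(v, w) \<in> N" for v w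
  proof
    assume "(w, v) \<in> N"
    then obtain u' x' y' where 2: "pendant_triangle G u' w v y' x'" "(w, y') \<in> marcs H"
      unfolding N_def by blast
    obtain u x y where 1: "pendant_triangle G u v w x y" "(v, x) \<in> marcs H"
      using vw unfolding N_def by blast
    have "y' = y" using pendant_triangle_unique[OF 1(1) pendant_triangle_sym[OF 2(1)]] by blast
    then show False using 1 2 sos[OF 1(1)] arc by blast
  qed
  have N_arc: "(v, w) \<notin> marcs H" "(w, v) \<notin> marcs H" if "(v, w) \<in> N" for v w
    using that arc(4) by (fastforce simp: N_def insert_commute)+
  have K_arc: "q \<in> nbrs ?D p \<and> (q, p) \<notin> marcs K \<and> {p, q} \<notin> medges K" if "(p, q) \<in> marcs K" for p q
  proof (cases "(p, q) \<in> N")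
    case True
    then have "{p, q} \<notin> medges K" unfolding N_def K_def by simp blast
    with True show ?thesis using N_nbrs N_anti N_arc unfolding arcs_K by blast
  next
    case False
    then have a: "(p, q) \<in> marcs H" "p \<notin> R" "q \<notin> R" using that arcs_K by auto
    then have "(q, p) \<notin> marcs K" "{p, q} \<notin> medges K"
      using arc N_arc unfolding arcs_K by (blast, simp add: K_def)
    with a show ?thesis using arc(1) by (simp add: nbrs_delete_verts)
  qed
  have po: "partial_orientation K ?D"
  proof (rule partial_orientationI[OF simple_graph_delete_verts[OF G] _ _ K_arc])
    show "mverts K = verts ?D" by (simp add: K_def delete_verts_def)
    show "medges K \<subseteq> edges ?D"
      using H(1) by (auto simp: K_def delete_verts_def partial_orientation_def)
    fix p q assume pq: "q \<in> nbrs ?D p"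
    then have pq': "q \<in> nbrs G p" "p \<notin> R" "q \<notin> R"
      by (auto simp: nbrs_delete_verts split: if_splits)
    then have "madj H p q" using madj_partial_orientation[OF H(1)] by simp
    then consider "(p, q) \<in> marcs H \<or> (q, p) \<in> marcs H" | "{p, q} \<in> medges H"
      by (auto simp: madj_def)
    then show "madj K p q"
    proof cases
      case 1
      then show ?thesis using pq' by (auto simp: madj_def arcs_K)
    next
      case 2
      show ?thesis
      proof (cases "\<exists>u x y. pendant_triangle G u p q x y")
        case True
        then obtain u x y where t: "pendant_triangle G u p q x y" by blast
        \<comment> \<open>Either \<open>p\<close> or \<open>q\<close> is the source; the second case
          uses the triangle with its corners swapped.\<close>
        then have "(p, q) \<in> N \<or> (q, p) \<in> N"
          using sos[OF t] 2 t pendant_triangle_sym[OF t] insert_commute[of p q "{}"]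
          unfolding N_def by simp metis
        then show ?thesis by (auto simp: madj_def arcs_K)
      next
        case False
        then have "\<not> (\<exists>u v w x y. pendant_triangle G u v w x y \<and> {p, q} = {v, w})"
          using pendant_triangle_sym by (metis doubleton_eq_iff)
        with 2 pq' show ?thesis by (auto simp: madj_def K_def)
      qed
    qed
  qed simp_all
  \<comment> \<open>Without \<open>u\<close>, the only neighbours of \<open>v\<close> are
    \<open>w\<close> and \<open>x\<close>, both reached by arcs from \<open>v\<close>; dually, both
    \<open>v\<close> and \<open>y\<close> send arcs to \<open>w\<close>.\<close>
  have N_source_sink: "(r, v) \<notin> marcs K \<and> (w, r) \<notin> marcs K" if vw: "(v, w) \<in> N" for v w r
  proof -
    obtain u x y where t: "pendant_triangle G u v w x y" "(v, x) \<in> marcs H"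
      using vw unfolding N_def by blast
    have yw: "(y, w) \<in> marcs H" using sos[OF t(1)] t(2) arc by blast
    have nr: "v \<notin> R" "x \<notin> R" "w \<notin> R" "y \<notin> R"
      using nrem[OF t(1)] nrem[OF pendant_triangle_sym[OF t(1)]] R by auto
    have u: "u \<in> R" using t(1) removable_iff_pendant_triangle[OF G] R by blast
    have K1: "(v, w) \<in> marcs K" "(v, x) \<in> marcs K" "(y, w) \<in> marcs K"
      using vw t yw nr by (auto simp: arcs_K)
    have D: "nbrs ?D v \<subseteq> {w, x}" "nbrs ?D w \<subseteq> {v, y}"
      using t(1) u by (auto simp: nbrs_delete_verts pendant_triangle_def)
    have "r \<in> {w, x}" if "(r, v) \<in> marcs K"
      using K_arc[OF that] D(1) nbrs_sym[of v ?D r] by blast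
    moreover have "r \<in> {v, y}" if "(w, r) \<in> marcs K"
      using K_arc[OF that] D(2) by blast
    ultimately show ?thesis using K1 K_arc by blast
  qed
  have "\<not> induced_two_dipath K p q r" for p q r
  proof
    assume "induced_two_dipath K p q r"
    then have a: "(p, q) \<in> marcs K" "(q, r) \<in> marcs K" "r \<notin> nbrs ?D p"
      using madj_partial_orientation[OF po] by (auto simp: induced_two_dipath_def two_dipath_def)
    \<comment> \<open>No 2-dipath uses a new arc, so it already lies in \<open>H\<close>.\<close>
    then have "(p, q) \<notin> N" "(q, r) \<notin> N" using N_source_sink by blast+
    then have "(p, q) \<in> marcs H" "(q, r) \<in> marcs H" "p \<notin> R" "r \<notin> R" using a arcs_K by auto
    then show False
      using quasi_transitive_two_dipath_adj[OF H] a(3) by (auto simp: nbrs_delete_verts)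
  qed
  moreover have "\<exists>s. two_dipath K p s q \<or> two_dipath K q s p" if e: "{p, q} \<in> medges K" for p q
  proof -
    have e': "{p, q} \<in> medges H" "p \<notin> R" "q \<notin> R"
      and nt: "\<not> pendant_triangle G u p q x y" for u x y
      using e unfolding K_def by (simp_all, blast)
    then obtain s where s: "two_dipath H p s q \<or> two_dipath H q s p"
      using H(2) unfolding quasi_transitive_def by blast
    \<comment> \<open>A removable middle vertex would make \<open>pq\<close> the opposite edge of
      its triangle, and such edges are not kept undirected.\<close>
    have "s \<notin> R"
    proof
      assume "s \<in> R"
      then obtain v w x y where t: "pendant_triangle G s v w x y"
        using R removable_iff_pendant_triangle[OF G] by blast
      have "p \<in> nbrs G s" "q \<in> nbrs G s" "p \<noteq> q"
        using s arc by (auto simp: two_dipath_def)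
      then have "p = v \<and> q = w \<or> p = w \<and> q = v" using t by (auto simp: pendant_triangle_def)
      then show False using t pendant_triangle_sym[OF t] nt by blast
    qed
    then show ?thesis using s e' by (auto simp: two_dipath_def arcs_K)
  qed
  ultimately have "quasi_transitive K" unfolding quasi_transitive_def by blast
  with po show ?thesis by blast
qed

subsection \<open>Restoring the removable vertices\<close>

text \<open>After deletion \<open>x\<close>, \<open>v\<close>, \<open>w\<close>, \<open>y\<close>
  form a path whose edges lie in no triangle, so all three are arcs. With
  \<open>v \<rightarrow> w\<close>, the arcs \<open>x \<rightarrow> v\<close> or
  \<open>w \<rightarrow> y\<close> would give an induced 2-dipath.\<close>

lemma pendant_triangle_arc_deleted:
  assumes G: "simple_graph G" and R: "R = {u. removable G u}"
    and H: "partial_orientation H (delete_verts G R)" "quasi_transitive H"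
    and t: "pendant_triangle G u v w x y"
  shows "(v, w) \<in> marcs H \<or> (w, v) \<in> marcs H"
    and "(v, w) \<in> marcs H \<Longrightarrow> (v, x) \<in> marcs H \<and> (y, w) \<in> marcs H"
proof -
  let ?D = "delete_verts G R"
  note t' = pendant_triangle_sym[OF t]
  have nr: "v \<notin> R" "x \<notin> R" "w \<notin> R" "y \<notin> R" and u: "u \<in> R"
    using pendant_triangle_not_removable[OF G t] pendant_triangle_not_removable[OF G t']
      t removable_iff_pendant_triangle[OF G] R by blast+
  have D: "nbrs ?D v = {w, x}" "nbrs ?D w = {v, y}"
    using t u nr by (auto simp: nbrs_delete_verts pendant_triangle_def)
  have na: "w \<notin> nbrs ?D x" "y \<notin> nbrs ?D v" "x \<notin> nbrs ?D w"
    using t D nbrs_sym[of x ?D w] by (auto simp: pendant_triangle_def)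
  have "nbrs ?D v \<inter> nbrs ?D w = {}" using D t by (auto simp: pendant_triangle_def)
  then show "(v, w) \<in> marcs H \<or> (w, v) \<in> marcs H"
    using quasi_transitive_triangle_free_arc[OF H] D by blast
  have "nbrs ?D v \<inter> nbrs ?D x = {}"
    using pendant_triangle_nbr_disjoint[OF G t] by (auto simp: nbrs_delete_verts)
  then have vx: "(v, x) \<in> marcs H \<or> (x, v) \<in> marcs H"
    using quasi_transitive_triangle_free_arc[OF H] D by blast
  have "nbrs ?D w \<inter> nbrs ?D y = {}"
    using pendant_triangle_nbr_disjoint[OF G t'] by (auto simp: nbrs_delete_verts)
  then have wy: "(w, y) \<in> marcs H \<or> (y, w) \<in> marcs H"
    using quasi_transitive_triangle_free_arc[OF H] D by blast
  show "(v, x) \<in> marcs H \<and> (y, w) \<in> marcs H" if "(v, w) \<in> marcs H"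
    using that vx wy na quasi_transitive_two_dipath_adj[OF H] by blast
qed

text \<open>Each removable vertex is inserted as \<open>v \<rightarrow> u \<rightarrow> w\<close>
  alongside the arc \<open>v \<rightarrow> w\<close>. Then \<open>v\<close> stays a source and
  \<open>w\<close> a sink, so no induced 2-dipath arises.\<close>

lemma quasi_transitive_restore_removable:
  assumes G: "simple_graph G" and R: "R = {u. removable G u}"
    and H: "partial_orientation H (delete_verts G R)" "quasi_transitive H"
  shows "\<exists>K. partial_orientation K G \<and> quasi_transitive K"
proof -
  \<comment> \<open>\<open>S\<close> collects the new arcs into removable vertices, \<open>T\<close>
    those out of them.\<close>
  define S where "S = {(v, u). \<exists>w x y. pendant_triangle G u v w x y \<and> (v, w) \<in> marcs H}"
  define T where "T = {(u, w). \<exists>v x y. pendant_triangle G u v w x y \<and> (v, w) \<in> marcs H}"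
  define K where "K = \<lparr>mverts = verts G, medges = medges H, marcs = marcs H \<union> S \<union> T\<rparr>"
  let ?D = "delete_verts G R"
  note arc = partial_orientation_arc[OF H(1)]
  note tri = pendant_triangle_arc_deleted[OF G R H]
  have R_tri: "u \<in> R \<longleftrightarrow> (\<exists>v w x y. pendant_triangle G u v w x y)" for u
    using R removable_iff_pendant_triangle[OF G] by blast
  have D_nbrs: "q \<in> nbrs ?D p \<longleftrightarrow> q \<in> nbrs G p \<and> p \<notin> R \<and> q \<notin> R" for p q
    by (auto simp: nbrs_delete_verts)
  have arcs_K: "(p, q) \<in> marcs K \<longleftrightarrow> (p, q) \<in> marcs H \<or> (p, q) \<in> S \<or> (p, q) \<in> T" for p q
    by (auto simp: K_def)
  have H_arc: "q \<in> nbrs G p" "p \<notin> R" "q \<notin> R" if "(p, q) \<in> marcs H" for p q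
    using arc(1)[OF that] D_nbrs by blast+
  have H_edge: "p \<notin> R \<and> q \<notin> R" if "{p, q} \<in> medges H" for p q
    using that madj_partial_orientation[OF H(1), of p q] D_nbrs by (auto simp: madj_def)
  have S_R: "q \<in> R \<and> p \<notin> R \<and> q \<in> nbrs G p" if pq: "(p, q) \<in> S" for p q
  proof -
    obtain w x y where t: "pendant_triangle G q p w x y" "(p, w) \<in> marcs H"
      using pq unfolding S_def by blast
    then show ?thesis using R_tri H_arc(2)[OF t(2)] by (auto simp: pendant_triangle_def)
  qed
  have T_R: "p \<in> R \<and> q \<notin> R \<and> q \<in> nbrs G p" if pq: "(p, q) \<in> T" for p q
  proof -
    obtain v x y where t: "pendant_triangle G p v q x y" "(v, q) \<in> marcs H"
      using pq unfolding T_def by blast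
    then show ?thesis using R_tri H_arc(3)[OF t(2)] by (auto simp: pendant_triangle_def)
  qed
  \<comment> \<open>Arcs of \<open>H\<close> avoid \<open>R\<close>, and \<open>S\<close> and
    \<open>T\<close> cross between \<open>R\<close> and its complement in opposite directions, so
    this is the only possible clash. It would force \<open>v = w\<close> and hence opposite arcs in
    \<open>H\<close>.\<close>
  have ST_anti: "(q, p) \<notin> T" if pq: "(p, q) \<in> S" for p q
  proof
    assume "(q, p) \<in> T"
    then obtain v x y where 1: "pendant_triangle G q v p x y" "(v, p) \<in> marcs H"
      unfolding T_def by blast
    obtain w x' y' where 2: "pendant_triangle G q p w x' y'" "(p, w) \<in> marcs H"
      using pq unfolding S_def by blast
    have "v = w" using 1 2 by (auto simp: pendant_triangle_def)
    then show False using 1 2 arc by blast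
  qed
  have K_arc: "q \<in> nbrs G p \<and> (q, p) \<notin> marcs K \<and> {p, q} \<notin> medges K" if "(p, q) \<in> marcs K" for p q
  proof -
    have e: "medges K = medges H" by (simp add: K_def)
    from that consider "(p, q) \<in> marcs H" | "(p, q) \<in> S" | "(p, q) \<in> T" using arcs_K by blast
    then show ?thesis
    proof cases
      case 1
      then show ?thesis using arc H_arc S_R T_R unfolding arcs_K e by blast
    next
      case 2
      then show ?thesis
        using H_arc[of q p] H_edge[of p q] S_R[of p q] S_R[of q p] ST_anti unfolding arcs_K e by blast
    next
      case 3
      then show ?thesis
        using H_arc[of q p] H_edge[of p q] T_R[of p q] T_R[of q p] ST_anti unfolding arcs_K e by blast
    qed
  qed
  have new_arc: "(u, p) \<in> marcs K \<or> (p, u) \<in> marcs K" if u: "u \<in> R" and p: "p \<in> nbrs G u" for u p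
  proof -
    obtain v w x y where t: "pendant_triangle G u v w x y" using u R_tri by blast
    note t' = pendant_triangle_sym[OF t]
    have "p = v \<or> p = w" using t p by (auto simp: pendant_triangle_def)
    then show ?thesis using t t' tri(1)[OF t] unfolding arcs_K S_def T_def by blast
  qed
  have po: "partial_orientation K G"
  proof (rule partial_orientationI[OF G _ _ K_arc])
    show "mverts K = verts G" by (simp add: K_def)
    show "medges K \<subseteq> edges G"
      using H(1) by (auto simp: K_def delete_verts_def partial_orientation_def)
    fix p q assume pq: "q \<in> nbrs G p"
    show "madj K p q"
    proof (cases "p \<in> R \<or> q \<in> R")
      case True
      then show ?thesis using new_arc pq nbrs_sym[of q G p] unfolding madj_def by blast
    next
      case False
      then have "madj H p q" using pq madj_partial_orientation[OF H(1)] D_nbrs by blast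
      then show ?thesis by (auto simp: madj_def K_def)
    qed
  qed simp_all
  \<comment> \<open>All three edges at \<open>v\<close> are outgoing arcs and all three at
    \<open>w\<close> are incoming.\<close>
  have source_sink: "(r, v) \<notin> marcs K \<and> (w, r) \<notin> marcs K"
    if t: "pendant_triangle G u v w x y" and vw: "(v, w) \<in> marcs H" for u v w x y r
  proof -
    have "(v, w) \<in> marcs K" "(v, x) \<in> marcs K" "(y, w) \<in> marcs K" "(v, u) \<in> marcs K" "(u, w) \<in> marcs K"
      using t vw tri(2)[OF t vw] unfolding arcs_K S_def T_def by blast+
    moreover have "r \<in> {u, w, x}" if "(r, v) \<in> marcs K"
      using K_arc[OF that] t nbrs_sym[of v G r] by (auto simp: pendant_triangle_def)
    moreover have "r \<in> {u, v, y}" if "(w, r) \<in> marcs K"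
      using K_arc[OF that] t by (auto simp: pendant_triangle_def)
    ultimately show ?thesis using K_arc by blast
  qed
  have "\<not> induced_two_dipath K p q r" for p q r
  proof
    assume "induced_two_dipath K p q r"
    then have a: "(p, q) \<in> marcs K" "(q, r) \<in> marcs K" "r \<notin> nbrs G p" "p \<noteq> r"
      using madj_partial_orientation[OF po] by (auto simp: induced_two_dipath_def two_dipath_def)
    \<comment> \<open>Arcs of \<open>T\<close> end in sinks and arcs of \<open>S\<close> start in
      sources, so neither fits here.\<close>
    have "(p, q) \<notin> T" "(q, r) \<notin> S"
      using a source_sink unfolding S_def T_def by blast+
    \<comment> \<open>The two neighbours of a removable middle vertex are adjacent. Thus
      \<open>q\<close> is not in \<open>R\<close>, which excludes the remaining new arcs.\<close>
    moreover have False if "q \<in> R"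
    proof -
      obtain v w x y where t: "pendant_triangle G q v w x y" using \<open>q \<in> R\<close> R_tri by blast
      have "{p, r} \<subseteq> nbrs G q"
        using K_arc[OF a(1)] K_arc[OF a(2)] nbrs_sym[of q G p] by blast
      then have "r \<in> nbrs G p" using t a(4) by (auto simp: pendant_triangle_def)
      then show False using a(3) by blast
    qed
    ultimately have "(p, q) \<in> marcs H" "(q, r) \<in> marcs H"
      using a S_R T_R arcs_K by blast+
    then show False
      using quasi_transitive_two_dipath_adj[OF H] a(3) D_nbrs by blast
  qed
  \<comment> \<open>The undirected edges are those of \<open>H\<close> and arcs are only added, so
    the old 2-dipaths still serve.\<close>
  moreover have "\<exists>s. two_dipath K p s q \<or> two_dipath K q s p" if "{p, q} \<in> medges K" for p q
  proof -
    have "{p, q} \<in> medges H" using that by (simp add: K_def)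
    then obtain s where "two_dipath H p s q \<or> two_dipath H q s p"
      using H(2) unfolding quasi_transitive_def by blast
    then show ?thesis by (auto simp: two_dipath_def arcs_K)
  qed
  ultimately have "quasi_transitive K" unfolding quasi_transitive_def by blast
  with po show ?thesis by blast
qed

theorem theorem3p3:
  fixes G :: "'a ugraph" and R :: "'a set"
  assumes "simple_graph G"
    and "has_max_degree G 3"
    and "R = {u. removable G u}"
  shows "(\<exists>H. partial_orientation H G \<and> quasi_transitive H) \<longleftrightarrow>
         (\<exists>H. partial_orientation H (delete_verts G R) \<and> quasi_transitive H)"
  using quasi_transitive_delete_removable[OF assms(1,3)]
    quasi_transitive_restore_removable[OF assms(1,3)] by blast

end
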